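(* Let $V,\Lambda,\mu_s,\mu_o,w_s,K>0$ with $V\ge\overline{C}_s$, where $$\overline{C}_s=\frac{w_s}{\mu_s}+2\sqrt{\frac{w_s}{\Lambda\mu_s}},\qquad \overline{C}_o=\frac{\bar L_o(3+\bar L_o)}{2\Lambda},\qquad \bar L_o=\max\Big\{L>0:\frac{L^3}{1+L}\le\frac{2\Lambda^2}{K\mu_o^2}\Big\}.$$ Let $\pi^*$, $\pi^S$, $\pi^O$ be the optimal profits of the service provider in the hybrid model, in System S (standard service only) and in System O (on-demand service only), and let $\Delta_o=1-\frac{\pi^S}{\pi^*}$ and $\Delta_s=1-\frac{\pi^O}{\pi^*}$ be the values of the on-demand service and of the standard service. Then $\Delta_o$ increases in $K$, $\Delta_s$ decreases in $w_s$, and $$0\le\Delta_o\le\frac{\overline{C}_s}{V},\qquad 0\le\Delta_s\le\frac{\overline{C}_o}{V}.$$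
   Context: Customers arrive at rate $\Lambda$ and have types $\theta$ uniform on $[0,1]$. Service $i\in\{s,o\}$ (standard, on-demand) with price $p_i$ and lead time $W_i$ gives utility $U_i=V-p_i-\theta W_i$; each customer joins the service with the highest nonnegative utility or balks (each customer joins at most one service; if the two services are identical in price and lead time, any split is allowed). Hybrid model: the service provider chooses $p_s,p_o$, the number $k_s\ge0$ of employees (service rate $\mu_s$, hourly wage $w_s$), and the per-service wage $w_o$ of contractors (service rate $\mu_o$, pool size $K$, reservation rates $r$ uniform on $[0,1]$), to maximize $p_s\lambda_s-w_sk_s+p_o\lambda_o-\lambda_ow_o$ subject to $\lambda_s=\Lambda\Pr(U_s\ge0,U_s\ge U_o)$, $\lambda_o=\Lambda\Pr(U_o\ge0,U_o\ge U_s)$, $W_i=1/(k_i\mu_i-\lambda_i)$ with $k_i\mu_i>\lambda_i$, and $k_o=K\Pr(\lambda_ow_o/k_o\ge r)$ with the uniform distribution function taken as $x\mapsto x$, i.e. $k_o^2=K\lambda_ow_o$. A service may be not offered ($\lambda_i=k_i=0$, no cost). $\pi^*$ is the optimal value (supremum). $\pi^S$ (resp. $\pi^O$) is the optimal value when only the standard (resp. only the on-demand) service is offered, where $\lambda_i=\Lambda\Pr(U_i\ge0)$ for the offered service $i$. "Increases/decreases" are in the weak sense. *)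

theory Defs
  imports "HOL-Probability.Probability"
begin

text \<open>Throughout, subscript \<open>s\<close> is the standard service (employees), \<open>o\<close> the on-demand
  service (contractors), and \<open>l\<close> is an arrival rate.\<close>

definition utility :: "real \<Rightarrow> real \<Rightarrow> real \<Rightarrow> real \<Rightarrow> real" where
  "utility V p W \<theta> = V - p - \<theta> * W"

abbreviation type_prob :: "(real \<Rightarrow> bool) \<Rightarrow> real" where
  "type_prob P \<equiv> \<P>(\<theta> in uniform_measure lborel {0..1}. P \<theta>)"

definition single_demand :: "real \<Rightarrow> real \<Rightarrow> real \<Rightarrow> real \<Rightarrow> real" where
  "single_demand V \<Lambda> p W = \<Lambda> * type_prob (\<lambda>\<theta>. utility V p W \<theta> \<ge> 0)"

text \<open>If the two services differ in price or lead time, at most one type is indifferent between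
  them, so the two events below overlap in a null set. If they coincide, every joining customer is
  indifferent and the arrivals may be split arbitrarily.\<close>

definition dual_demand ::
  "real \<Rightarrow> real \<Rightarrow> real \<Rightarrow> real \<Rightarrow> real \<Rightarrow> real \<Rightarrow> real \<Rightarrow> real \<Rightarrow> bool" where
  "dual_demand V \<Lambda> p\<^sub>s W\<^sub>s p\<^sub>o W\<^sub>o l\<^sub>s l\<^sub>o \<longleftrightarrow>
     (if p\<^sub>s = p\<^sub>o \<and> W\<^sub>s = W\<^sub>o
      then l\<^sub>s \<ge> 0 \<and> l\<^sub>o \<ge> 0 \<and> l\<^sub>s + l\<^sub>o = single_demand V \<Lambda> p\<^sub>s W\<^sub>s
      else l\<^sub>s = \<Lambda> * type_prob (\<lambda>\<theta>. utility V p\<^sub>s W\<^sub>s \<theta> \<ge> 0 \<and>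
                                  utility V p\<^sub>s W\<^sub>s \<theta> \<ge> utility V p\<^sub>o W\<^sub>o \<theta>) \<and>
           l\<^sub>o = \<Lambda> * type_prob (\<lambda>\<theta>. utility V p\<^sub>o W\<^sub>o \<theta> \<ge> 0 \<and>
                                  utility V p\<^sub>o W\<^sub>o \<theta> \<ge> utility V p\<^sub>s W\<^sub>s \<theta>))"

definition lead_time :: "real \<Rightarrow> real \<Rightarrow> real \<Rightarrow> real \<Rightarrow> bool" where
  "lead_time k \<mu> l W \<longleftrightarrow> k * \<mu> > l \<and> W = 1 / (k * \<mu> - l)"

text \<open>Contractors join when their hourly earnings \<open>l w / k\<close> reach their reservation rate, so
  \<open>k = K F(l w / k)\<close>. The uniform distribution function is taken as \<open>F x = x\<close>, without the cap
  at 1.\<close>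

definition contractor_supply :: "real \<Rightarrow> real \<Rightarrow> real \<Rightarrow> real \<Rightarrow> bool" where
  "contractor_supply K l w k \<longleftrightarrow> k\<^sup>2 = K * l * w"

definition standard_profits :: "real \<Rightarrow> real \<Rightarrow> real \<Rightarrow> real \<Rightarrow> real set" where
  "standard_profits V \<Lambda> \<mu>\<^sub>s w\<^sub>s =
     {p\<^sub>s * l\<^sub>s - w\<^sub>s * k\<^sub>s | p\<^sub>s k\<^sub>s l\<^sub>s W\<^sub>s.
        k\<^sub>s \<ge> 0 \<and> l\<^sub>s = single_demand V \<Lambda> p\<^sub>s W\<^sub>s \<and> lead_time k\<^sub>s \<mu>\<^sub>s l\<^sub>s W\<^sub>s}"

definition ondemand_profits :: "real \<Rightarrow> real \<Rightarrow> real \<Rightarrow> real \<Rightarrow> real set" where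
  "ondemand_profits V \<Lambda> \<mu>\<^sub>o K =
     {p\<^sub>o * l\<^sub>o - l\<^sub>o * w\<^sub>o | p\<^sub>o w\<^sub>o k\<^sub>o l\<^sub>o W\<^sub>o.
        l\<^sub>o = single_demand V \<Lambda> p\<^sub>o W\<^sub>o \<and> lead_time k\<^sub>o \<mu>\<^sub>o l\<^sub>o W\<^sub>o \<and>
        contractor_supply K l\<^sub>o w\<^sub>o k\<^sub>o}"

definition dual_profits :: "real \<Rightarrow> real \<Rightarrow> real \<Rightarrow> real \<Rightarrow> real \<Rightarrow> real \<Rightarrow> real set" where
  "dual_profits V \<Lambda> \<mu>\<^sub>s \<mu>\<^sub>o w\<^sub>s K =
     {p\<^sub>s * l\<^sub>s - w\<^sub>s * k\<^sub>s + p\<^sub>o * l\<^sub>o - l\<^sub>o * w\<^sub>o | p\<^sub>s p\<^sub>o k\<^sub>s w\<^sub>o k\<^sub>o l\<^sub>s l\<^sub>o W\<^sub>s W\<^sub>o.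
        k\<^sub>s \<ge> 0 \<and> dual_demand V \<Lambda> p\<^sub>s W\<^sub>s p\<^sub>o W\<^sub>o l\<^sub>s l\<^sub>o \<and>
        lead_time k\<^sub>s \<mu>\<^sub>s l\<^sub>s W\<^sub>s \<and> lead_time k\<^sub>o \<mu>\<^sub>o l\<^sub>o W\<^sub>o \<and>
        contractor_supply K l\<^sub>o w\<^sub>o k\<^sub>o}"

text \<open>In the hybrid model either service, or both, may be left out; offering none earns 0.\<close>

definition hybrid_profits :: "real \<Rightarrow> real \<Rightarrow> real \<Rightarrow> real \<Rightarrow> real \<Rightarrow> real \<Rightarrow> real set" where
  "hybrid_profits V \<Lambda> \<mu>\<^sub>s \<mu>\<^sub>o w\<^sub>s K =
     dual_profits V \<Lambda> \<mu>\<^sub>s \<mu>\<^sub>o w\<^sub>s K \<union> standard_profits V \<Lambda> \<mu>\<^sub>s w\<^sub>s \<union>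
     ondemand_profits V \<Lambda> \<mu>\<^sub>o K \<union> {0}"

text \<open>For positive parameters the three sets below are nonempty and bounded above by \<open>\<Lambda> V\<close>
  (nobody pays more than \<open>V\<close>), so the real-valued \<^const>\<open>Sup\<close> is the true supremum.\<close>

definition profit_S :: "real \<Rightarrow> real \<Rightarrow> real \<Rightarrow> real \<Rightarrow> real" where
  "profit_S V \<Lambda> \<mu>\<^sub>s w\<^sub>s = Sup (standard_profits V \<Lambda> \<mu>\<^sub>s w\<^sub>s)"

definition profit_O :: "real \<Rightarrow> real \<Rightarrow> real \<Rightarrow> real \<Rightarrow> real" where
  "profit_O V \<Lambda> \<mu>\<^sub>o K = Sup (ondemand_profits V \<Lambda> \<mu>\<^sub>o K)"

definition profit_hybrid :: "real \<Rightarrow> real \<Rightarrow> real \<Rightarrow> real \<Rightarrow> real \<Rightarrow> real \<Rightarrow> real" where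
  "profit_hybrid V \<Lambda> \<mu>\<^sub>s \<mu>\<^sub>o w\<^sub>s K = Sup (hybrid_profits V \<Lambda> \<mu>\<^sub>s \<mu>\<^sub>o w\<^sub>s K)"

definition value_ondemand :: "real \<Rightarrow> real \<Rightarrow> real \<Rightarrow> real \<Rightarrow> real \<Rightarrow> real \<Rightarrow> real" where
  "value_ondemand V \<Lambda> \<mu>\<^sub>s \<mu>\<^sub>o w\<^sub>s K =
     1 - profit_S V \<Lambda> \<mu>\<^sub>s w\<^sub>s / profit_hybrid V \<Lambda> \<mu>\<^sub>s \<mu>\<^sub>o w\<^sub>s K"

definition value_standard :: "real \<Rightarrow> real \<Rightarrow> real \<Rightarrow> real \<Rightarrow> real \<Rightarrow> real \<Rightarrow> real" where
  "value_standard V \<Lambda> \<mu>\<^sub>s \<mu>\<^sub>o w\<^sub>s K =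
     1 - profit_O V \<Lambda> \<mu>\<^sub>o K / profit_hybrid V \<Lambda> \<mu>\<^sub>s \<mu>\<^sub>o w\<^sub>s K"

definition C_bar_s :: "real \<Rightarrow> real \<Rightarrow> real \<Rightarrow> real" where
  "C_bar_s \<Lambda> \<mu>\<^sub>s w\<^sub>s = w\<^sub>s / \<mu>\<^sub>s + 2 * sqrt (w\<^sub>s / (\<Lambda> * \<mu>\<^sub>s))"

definition L_bar_o :: "real \<Rightarrow> real \<Rightarrow> real \<Rightarrow> real" where
  "L_bar_o \<Lambda> \<mu>\<^sub>o K = (GREATEST L. L > 0 \<and> L ^ 3 / (1 + L) \<le> 2 * \<Lambda>\<^sup>2 / (K * \<mu>\<^sub>o\<^sup>2))"

definition C_bar_o :: "real \<Rightarrow> real \<Rightarrow> real \<Rightarrow> real" where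
  "C_bar_o \<Lambda> \<mu>\<^sub>o K = L_bar_o \<Lambda> \<mu>\<^sub>o K * (3 + L_bar_o \<Lambda> \<mu>\<^sub>o K) / (2 * \<Lambda>)"

end

theory Submission imports Defs
begin

text \<open>Every hybrid profit is at most \<open>\<Lambda> V\<close>: nobody pays more than \<open>V\<close>, and outside the tie case
  at most one type is indifferent, so the two demands sum to at most \<open>\<Lambda>\<close>. Serving the whole market
  with one service at the lead time that balances waiting against staffing costs earns
  \<open>\<Lambda> (V - C)\<close> with \<open>C\<close> the corresponding constant; these two facts give the bounds. Monotonicity
  holds because a configuration stays feasible, and gets cheaper, when \<open>w\<^sub>s\<close> drops or when \<open>K\<close> grows
  and the contractors' wage is scaled down to keep \<open>K w\<^sub>o\<close> fixed.\<close>

section \<open>Probabilities over the uniform customer type\<close>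

lemma prob_space_type: "prob_space (uniform_measure lborel {0..1::real})"
  by (rule prob_space_uniform_measure) auto

lemma type_prob_nonneg: "0 \<le> type_prob P"
  by (rule measure_nonneg)

lemma type_prob_le_1: "type_prob P \<le> 1"
  using prob_space.prob_le_1[OF prob_space_type] .

lemma type_prob_eq:
  assumes [measurable]: "Measurable.pred borel P"
  shows "type_prob P = measure lborel ({0..1} \<inter> {\<theta>. P \<theta>})"
  by (subst measure_uniform_measure) auto

lemma type_prob_eq_0:
  assumes "Measurable.pred borel P" and "\<And>\<theta>. 0 \<le> \<theta> \<Longrightarrow> \<theta> \<le> 1 \<Longrightarrow> \<not> P \<theta>"
  shows "type_prob P = 0"
proof -
  have "{0..1} \<inter> {\<theta>. P \<theta>} = {}" using assms(2) by auto
  then show ?thesis unfolding type_prob_eq[OF assms(1)] by simp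
qed

text \<open>A finite overlap is Lebesgue-null, so inclusion-exclusion on \<open>{0..1}\<close> has
  no correction term.\<close>

lemma type_prob_add_le_1:
  assumes [measurable]: "Measurable.pred borel P" "Measurable.pred borel Q"
    and fin: "finite {\<theta>. P \<theta> \<and> Q \<theta>}"
  shows "type_prob P + type_prob Q \<le> 1"
proof -
  let ?A = "{0..1} \<inter> {\<theta>. P \<theta>}" and ?B = "{0..1} \<inter> {\<theta>. Q \<theta>}"
  have meas: "?A \<in> sets lborel" "?B \<in> sets lborel" by measurable
  have I: "{0..1::real} \<in> fmeasurable lborel" by (simp add: fmeasurable_def)
  have fm: "?A \<in> fmeasurable lborel" "?B \<in> fmeasurable lborel"
    using fmeasurableI2[OF I] meas by auto
  have "finite (?A \<inter> ?B)" by (rule finite_subset[OF _ fin]) auto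
  then have "measure lborel (?A \<inter> ?B) = 0"
    using finite_imp_null_set_lborel null_sets_def measure_def by (metis measure_eq_0_null_sets)
  then have "measure lborel ?A + measure lborel ?B = measure lborel (?A \<union> ?B)"
    using measure_Un3[OF fm] by simp
  also have "\<dots> \<le> measure lborel {0..1::real}"
    by (rule measure_mono_fmeasurable) (use meas I in auto)
  finally show ?thesis by (simp add: type_prob_eq)
qed

section \<open>Revenue bounds\<close>

lemma utility_pred [measurable]: "(\<lambda>\<theta>. utility V p W \<theta>) \<in> borel_measurable borel"
  unfolding utility_def by measurable

lemma lead_time_pos: "lead_time k \<mu> l W \<Longrightarrow> W > 0"
  by (simp add: lead_time_def)

text \<open>A price above \<open>V\<close> leaves every type in \<open>{0..1}\<close> with negative
  utility, so demand vanishes and both sides are 0. \<open>P\<close> stays general to cover a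
  service alone as well as next to a competitor.\<close>

lemma revenue_le:
  assumes "\<Lambda> > 0" "W > 0" "Measurable.pred borel P"
    and "\<And>\<theta>. P \<theta> \<Longrightarrow> utility V p W \<theta> \<ge> 0"
  shows "p * (\<Lambda> * type_prob P) \<le> V * (\<Lambda> * type_prob P)"
proof (cases "p \<le> V")
  case True
  then show ?thesis
    using assms(1) type_prob_nonneg by (intro mult_right_mono) auto
next
  case False
  have "type_prob P = 0"
  proof (rule type_prob_eq_0[OF assms(3)])
    fix \<theta> :: real assume "0 \<le> \<theta>"
    then have "\<theta> * W \<ge> 0" using assms(2) by simp
    then show "\<not> P \<theta>" using False assms(4)[of \<theta>] by (auto simp: utility_def)
  qed
  then show ?thesis by simp
qed

lemma single_revenue_le:
  assumes "V > 0" "\<Lambda> > 0" "W > 0"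
  shows "p * single_demand V \<Lambda> p W \<le> \<Lambda> * V"
proof -
  have "p * single_demand V \<Lambda> p W \<le> V * single_demand V \<Lambda> p W"
    unfolding single_demand_def by (rule revenue_le) (use assms in auto)
  also have "\<dots> \<le> V * (\<Lambda> * 1)"
    unfolding single_demand_def using assms by (intro mult_left_mono type_prob_le_1) auto
  finally show ?thesis by (simp add: mult.commute)
qed

lemma dual_revenue_le:
  assumes "V > 0" "\<Lambda> > 0" "Ws > 0" "Wo > 0" and dd: "dual_demand V \<Lambda> ps Ws po Wo ls lo"
  shows "ps * ls + po * lo \<le> \<Lambda> * V"
proof (cases "ps = po \<and> Ws = Wo")
  case True
  \<comment> \<open>Tied services share one price, so together they earn what a single service
    would.\<close>
  then have "ps * ls + po * lo = ps * single_demand V \<Lambda> ps Ws"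
    using dd by (simp add: dual_demand_def flip: distrib_left)
  then show ?thesis using single_revenue_le assms by simp
next
  case False
  define P where "P \<theta> \<longleftrightarrow> utility V ps Ws \<theta> \<ge> 0 \<and> utility V ps Ws \<theta> \<ge> utility V po Wo \<theta>" for \<theta>
  define Q where "Q \<theta> \<longleftrightarrow> utility V po Wo \<theta> \<ge> 0 \<and> utility V po Wo \<theta> \<ge> utility V ps Ws \<theta>" for \<theta>
  have PQ [measurable]: "Measurable.pred borel P" "Measurable.pred borel Q"
    unfolding P_def Q_def by measurable
  have ls: "ls = \<Lambda> * type_prob P" and lo: "lo = \<Lambda> * type_prob Q"
    using False dd by (auto simp: dual_demand_def P_def Q_def)
  have "{\<theta>. P \<theta> \<and> Q \<theta>} \<subseteq> {(po - ps) / (Ws - Wo)}"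
  proof
    fix \<theta> assume "\<theta> \<in> {\<theta>. P \<theta> \<and> Q \<theta>}"
    then have eq: "ps + \<theta> * Ws = po + \<theta> * Wo" by (auto simp: P_def Q_def utility_def)
    \<comment> \<open>Equal lead times would force equal prices, which is the excluded tie.\<close>
    then have "Ws \<noteq> Wo" using False by auto
    then show "\<theta> \<in> {(po - ps) / (Ws - Wo)}" using eq by (simp add: field_simps)
  qed
  then have "type_prob P + type_prob Q \<le> 1"
    by (intro type_prob_add_le_1 PQ) (rule finite_subset, auto)
  then have "\<Lambda> * V * (type_prob P + type_prob Q) \<le> \<Lambda> * V * 1"
    using assms(1,2) by (intro mult_left_mono) auto
  moreover have "ps * ls \<le> V * ls" "po * lo \<le> V * lo"
    unfolding ls lo by (rule revenue_le; use assms PQ in \<open>auto simp: P_def Q_def\<close>)+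
  ultimately show ?thesis unfolding ls lo by (simp add: algebra_simps)
qed

section \<open>Contractor supply and the cap on hybrid profits\<close>

text \<open>The sign of \<open>w\<close> is not restricted, but \<open>K * l * w\<close> is the
  square \<open>k\<^sup>2\<close>.\<close>

lemma contractor_cost_nonneg:
  assumes "K > 0" "contractor_supply K l w k"
  shows "0 \<le> l * w"
proof -
  have "0 \<le> K * (l * w)"
    using assms(2) zero_le_power2[of k] by (simp add: contractor_supply_def mult.assoc)
  then show ?thesis using assms(1) by (simp add: zero_le_mult_iff)
qed

text \<open>Supply depends on pool and wage only through \<open>K * w\<close>. The wage bill is
  nonnegative, so the factor \<open>K / K' \<le> 1\<close> cannot raise it.\<close>

lemma contractor_supply_scale:
  assumes "K > 0" "K \<le> K'" "contractor_supply K l w k"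
  shows "contractor_supply K' l (w * K / K') k" and "l * (w * K / K') \<le> l * w"
proof -
  show "contractor_supply K' l (w * K / K') k"
    using assms by (simp add: contractor_supply_def field_simps)
  have "l * w * (K / K') \<le> l * w * 1"
    using assms contractor_cost_nonneg[OF assms(1,3)] by (intro mult_left_mono) auto
  then show "l * (w * K / K') \<le> l * w" by simp
qed

lemma hybrid_profits_le:
  assumes "V > 0" "\<Lambda> > 0" "ws > 0" "K > 0" and x: "x \<in> hybrid_profits V \<Lambda> \<mu>s \<mu>o ws K"
  shows "x \<le> \<Lambda> * V"
proof -
  consider "x \<in> dual_profits V \<Lambda> \<mu>s \<mu>o ws K" | "x \<in> standard_profits V \<Lambda> \<mu>s ws"
    | "x \<in> ondemand_profits V \<Lambda> \<mu>o K" | "x = 0"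
    using x by (auto simp: hybrid_profits_def)
  then show ?thesis
  proof cases
    case 1
    then obtain ps po ks wo ko ls lo Ws Wo where
      x: "x = ps * ls - ws * ks + po * lo - lo * wo" and "ks \<ge> 0"
      and "dual_demand V \<Lambda> ps Ws po Wo ls lo"
      and "lead_time ks \<mu>s ls Ws" "lead_time ko \<mu>o lo Wo" "contractor_supply K lo wo ko"
      unfolding dual_profits_def by blast
    then have "ps * ls + po * lo \<le> \<Lambda> * V" "0 \<le> lo * wo" "0 \<le> ws * ks"
      using dual_revenue_le[OF assms(1,2)] lead_time_pos contractor_cost_nonneg[OF assms(4)]
        mult_nonneg_nonneg[of ws ks] assms(3) by (blast, blast, simp)
    then show ?thesis unfolding x by simp
  next
    case 2
    then obtain p k l W where x: "x = p * l - ws * k" and "k \<ge> 0" "l = single_demand V \<Lambda> p W"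
      "lead_time k \<mu>s l W"
      unfolding standard_profits_def by blast
    then have "p * l \<le> \<Lambda> * V" "0 \<le> ws * k"
      using assms single_revenue_le lead_time_pos by auto
    then show ?thesis unfolding x by simp
  next
    case 3
    then obtain p w k l W where x: "x = p * l - l * w" and "l = single_demand V \<Lambda> p W"
      "lead_time k \<mu>o l W" "contractor_supply K l w k"
      unfolding ondemand_profits_def by blast
    then have "p * l \<le> \<Lambda> * V" "0 \<le> l * w"
      using assms single_revenue_le lead_time_pos contractor_cost_nonneg by auto
    then show ?thesis unfolding x by simp
  next
    case 4
    then show ?thesis using assms by simp
  qed
qed

lemma bdd_above_hybrid:
  assumes "V > 0" "\<Lambda> > 0" "ws > 0" "K > 0"
  shows "bdd_above (hybrid_profits V \<Lambda> \<mu>s \<mu>o ws K)"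
  using hybrid_profits_le[OF assms] by (rule bdd_aboveI)

section \<open>Monotonicity of the hybrid optimum\<close>

text \<open>Everything but the contractors' wage is kept. The profit moves with the wage, hence
  domination by some \<open>y\<close>, which is enough to compare suprema, in place of set
  inclusion.\<close>

lemma hybrid_profits_increase_K:
  assumes "K > 0" "K \<le> K'" and x: "x \<in> hybrid_profits V \<Lambda> \<mu>s \<mu>o ws K"
  shows "\<exists>y\<in>hybrid_profits V \<Lambda> \<mu>s \<mu>o ws K'. x \<le> y"
proof -
  consider "x \<in> dual_profits V \<Lambda> \<mu>s \<mu>o ws K" | "x \<in> standard_profits V \<Lambda> \<mu>s ws \<union> {0}"
    | "x \<in> ondemand_profits V \<Lambda> \<mu>o K"
    using x by (auto simp: hybrid_profits_def)
  then show ?thesis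
  proof cases
    case 1
    then obtain ps po ks wo ko ls lo Ws Wo where
      x: "x = ps * ls - ws * ks + po * lo - lo * wo" and c: "ks \<ge> 0"
      "dual_demand V \<Lambda> ps Ws po Wo ls lo"
      "lead_time ks \<mu>s ls Ws" "lead_time ko \<mu>o lo Wo" and s: "contractor_supply K lo wo ko"
      unfolding dual_profits_def by blast
    note s' = contractor_supply_scale[OF assms(1,2) s]
    have "ps * ls - ws * ks + po * lo - lo * (wo * K / K') \<in> dual_profits V \<Lambda> \<mu>s \<mu>o ws K'"
      unfolding dual_profits_def using c s'(1) by blast
    then show ?thesis
      using s'(2) unfolding x hybrid_profits_def by (intro bexI[rotated]) auto
  next
    case 2
    then show ?thesis by (auto simp: hybrid_profits_def)
  next
    case 3
    then obtain p w k l W where x: "x = p * l - l * w" and c: "l = single_demand V \<Lambda> p W"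
      "lead_time k \<mu>o l W" and s: "contractor_supply K l w k"
      unfolding ondemand_profits_def by blast
    note s' = contractor_supply_scale[OF assms(1,2) s]
    have "p * l - l * (w * K / K') \<in> ondemand_profits V \<Lambda> \<mu>o K'"
      unfolding ondemand_profits_def using c s'(1) by blast
    then show ?thesis
      using s'(2) unfolding x hybrid_profits_def by (intro bexI[rotated]) auto
  qed
qed

text \<open>The employees' wage enters no constraint, only the staffing cost, and
  \<open>ks \<ge> 0\<close>.\<close>

lemma hybrid_profits_decrease_ws:
  assumes "w \<le> w'" and x: "x \<in> hybrid_profits V \<Lambda> \<mu>s \<mu>o w' K"
  shows "\<exists>y\<in>hybrid_profits V \<Lambda> \<mu>s \<mu>o w K. x \<le> y"
proof -
  consider "x \<in> dual_profits V \<Lambda> \<mu>s \<mu>o w' K" | "x \<in> standard_profits V \<Lambda> \<mu>s w'"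
    | "x \<in> ondemand_profits V \<Lambda> \<mu>o K \<union> {0}"
    using x by (auto simp: hybrid_profits_def)
  then show ?thesis
  proof cases
    case 1
    then obtain ps po ks wo ko ls lo Ws Wo where
      x: "x = ps * ls - w' * ks + po * lo - lo * wo" and c: "ks \<ge> 0"
      "dual_demand V \<Lambda> ps Ws po Wo ls lo"
      "lead_time ks \<mu>s ls Ws" "lead_time ko \<mu>o lo Wo" "contractor_supply K lo wo ko"
      unfolding dual_profits_def by blast
    have "ps * ls - w * ks + po * lo - lo * wo \<in> dual_profits V \<Lambda> \<mu>s \<mu>o w K"
      unfolding dual_profits_def using c by blast
    moreover have "w * ks \<le> w' * ks" using assms(1) c(1) by (rule mult_right_mono)
    ultimately show ?thesis
      unfolding x hybrid_profits_def by (intro bexI[rotated]) auto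
  next
    case 2
    then obtain p k l W where x: "x = p * l - w' * k" and c: "k \<ge> 0" "l = single_demand V \<Lambda> p W"
      "lead_time k \<mu>s l W"
      unfolding standard_profits_def by blast
    have "p * l - w * k \<in> standard_profits V \<Lambda> \<mu>s w"
      unfolding standard_profits_def using c by blast
    moreover have "w * k \<le> w' * k" using assms(1) c(1) by (rule mult_right_mono)
    ultimately show ?thesis
      unfolding x hybrid_profits_def by (intro bexI[rotated]) auto
  next
    case 3
    then show ?thesis by (auto simp: hybrid_profits_def)
  qed
qed

lemma profit_hybrid_mono_K:
  assumes "V > 0" "\<Lambda> > 0" "ws > 0" "0 < K" "K \<le> K'"
  shows "profit_hybrid V \<Lambda> \<mu>s \<mu>o ws K \<le> profit_hybrid V \<Lambda> \<mu>s \<mu>o ws K'"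
  unfolding profit_hybrid_def
  by (rule cSup_mono)
    (use assms bdd_above_hybrid hybrid_profits_increase_K in \<open>auto simp: hybrid_profits_def[of _ _ _ _ _ K]\<close>)

lemma profit_hybrid_antimono_ws:
  assumes "V > 0" "\<Lambda> > 0" "K > 0" "0 < w" "w \<le> w'"
  shows "profit_hybrid V \<Lambda> \<mu>s \<mu>o w' K \<le> profit_hybrid V \<Lambda> \<mu>s \<mu>o w K"
  unfolding profit_hybrid_def
  by (rule cSup_mono)
    (use assms bdd_above_hybrid hybrid_profits_decrease_ws in \<open>auto simp: hybrid_profits_def[of _ _ _ _ w']\<close>)

lemma profit_hybrid_bounds:
  assumes "V > 0" "\<Lambda> > 0" "ws > 0" "K > 0"
  shows "0 \<le> profit_hybrid V \<Lambda> \<mu>s \<mu>o ws K" "profit_hybrid V \<Lambda> \<mu>s \<mu>o ws K \<le> \<Lambda> * V"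
proof -
  have "0 \<in> hybrid_profits V \<Lambda> \<mu>s \<mu>o ws K" by (simp add: hybrid_profits_def)
  then show "0 \<le> profit_hybrid V \<Lambda> \<mu>s \<mu>o ws K" "profit_hybrid V \<Lambda> \<mu>s \<mu>o ws K \<le> \<Lambda> * V"
    unfolding profit_hybrid_def
    using bdd_above_hybrid hybrid_profits_le assms by (auto intro!: cSup_upper cSup_least)
qed

section \<open>Explicit configurations parametrized by lead time and demand\<close>

text \<open>The price makes type \<open>l / \<Lambda>\<close> indifferent to balking, so exactly the
  types up to it join.\<close>

lemma single_demand_interior:
  assumes "\<Lambda> > 0" "W > 0" "0 < l" "l \<le> \<Lambda>"
  shows "single_demand V \<Lambda> (V - W * l / \<Lambda>) W = l"
proof -
  have "utility V (V - W * l / \<Lambda>) W \<theta> \<ge> 0 \<longleftrightarrow> \<theta> \<le> l / \<Lambda>" for \<theta>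
  proof -
    have "utility V (V - W * l / \<Lambda>) W \<theta> = W * (l / \<Lambda> - \<theta>)"
      by (simp add: utility_def algebra_simps)
    then show ?thesis using assms(2) by (simp add: zero_le_mult_iff)
  qed
  moreover have "l / \<Lambda> \<le> 1" using assms by simp
  then have "{0..1} \<inter> {\<theta>. \<theta> \<le> l / \<Lambda>} = {0..l / \<Lambda>}" by auto
  ultimately show ?thesis
    using assms by (simp add: single_demand_def type_prob_eq)
qed

text \<open>Lead time \<open>W\<close> forces capacity \<open>l + 1 / W\<close>, and demand
  \<open>l\<close> is induced by the price \<open>V - W * l / \<Lambda>\<close>; this leaves
  \<open>W\<close> and \<open>l\<close> as free parameters.\<close>

lemma standard_profit_mem:
  assumes "\<Lambda> > 0" "\<mu> > 0" "W > 0" "0 < l" "l \<le> \<Lambda>"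
  shows "V * l - W * l\<^sup>2 / \<Lambda> - w * ((l + 1 / W) / \<mu>) \<in> standard_profits V \<Lambda> \<mu> w"
proof -
  define p k where "p = V - W * l / \<Lambda>" and "k = (l + 1 / W) / \<mu>"
  have "l = single_demand V \<Lambda> p W" "lead_time k \<mu> l W" "k \<ge> 0"
    using assms single_demand_interior by (auto simp: p_def k_def lead_time_def)
  moreover have "V * l - W * l\<^sup>2 / \<Lambda> - w * ((l + 1 / W) / \<mu>) = p * l - w * k"
    by (simp add: p_def k_def algebra_simps power2_eq_square)
  ultimately show ?thesis unfolding standard_profits_def by blast
qed

lemma ondemand_profit_mem:
  assumes "\<Lambda> > 0" "\<mu> > 0" "K > 0" "W > 0" "0 < l" "l \<le> \<Lambda>"
  shows "V * l - W * l\<^sup>2 / \<Lambda> - (l + 1 / W)\<^sup>2 / (K * \<mu>\<^sup>2) \<in> ondemand_profits V \<Lambda> \<mu> K"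
proof -
  define p k where "p = V - W * l / \<Lambda>" and "k = (l + 1 / W) / \<mu>"
  \<comment> \<open>The supply equation solved for the wage, so the wage bill becomes
    \<open>k\<^sup>2 / K\<close>.\<close>
  define w where "w = k\<^sup>2 / (K * l)"
  have "l = single_demand V \<Lambda> p W" "lead_time k \<mu> l W" "contractor_supply K l w k"
    using assms single_demand_interior
    by (auto simp: p_def k_def w_def lead_time_def contractor_supply_def)
  moreover have "l * w = (l + 1 / W)\<^sup>2 / (K * \<mu>\<^sup>2)"
    using assms by (simp add: w_def k_def power_divide mult.commute)
  then have "V * l - W * l\<^sup>2 / \<Lambda> - (l + 1 / W)\<^sup>2 / (K * \<mu>\<^sup>2) = p * l - l * w"
    by (simp add: p_def algebra_simps power2_eq_square)
  ultimately show ?thesis unfolding ondemand_profits_def by blast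
qed

section \<open>Comparison of the optimal profits\<close>

lemma profit_S_le_hybrid:
  assumes "V > 0" "\<Lambda> > 0" "\<mu>s > 0" "ws > 0" "K > 0"
  shows "profit_S V \<Lambda> \<mu>s ws \<le> profit_hybrid V \<Lambda> \<mu>s \<mu>o ws K"
  unfolding profit_S_def profit_hybrid_def
proof (rule cSup_subset_mono)
  show "standard_profits V \<Lambda> \<mu>s ws \<noteq> {}"
    \<comment> \<open>An arbitrary admissible lead time and demand.\<close>
    using standard_profit_mem[of \<Lambda> \<mu>s 1 \<Lambda> V ws] assms by auto
qed (use bdd_above_hybrid assms in \<open>auto simp: hybrid_profits_def\<close>)

lemma profit_O_le_hybrid:
  assumes "V > 0" "\<Lambda> > 0" "\<mu>o > 0" "ws > 0" "K > 0"
  shows "profit_O V \<Lambda> \<mu>o K \<le> profit_hybrid V \<Lambda> \<mu>s \<mu>o ws K"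
  unfolding profit_O_def profit_hybrid_def
proof (rule cSup_subset_mono)
  show "ondemand_profits V \<Lambda> \<mu>o K \<noteq> {}"
    using ondemand_profit_mem[of \<Lambda> \<mu>o K 1 \<Lambda> V] assms by auto
qed (use bdd_above_hybrid assms in \<open>auto simp: hybrid_profits_def\<close>)

lemma le_profit_S:
  assumes "V > 0" "\<Lambda> > 0" "ws > 0" "x \<in> standard_profits V \<Lambda> \<mu>s ws"
  shows "x \<le> profit_S V \<Lambda> \<mu>s ws"
  unfolding profit_S_def
proof (rule cSup_upper[OF assms(4)])
  show "bdd_above (standard_profits V \<Lambda> \<mu>s ws)"
    \<comment> \<open>Boundedness is inherited from a hybrid model whose on-demand parameters
      \<open>K\<close> and \<open>\<mu>o\<close> are arbitrarily set to 1.\<close>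
    using bdd_above_hybrid[of V \<Lambda> ws 1 \<mu>s 1] assms
    by (auto elim!: bdd_above_mono simp: hybrid_profits_def)
qed

lemma le_profit_O:
  assumes "V > 0" "\<Lambda> > 0" "K > 0" "x \<in> ondemand_profits V \<Lambda> \<mu>o K"
  shows "x \<le> profit_O V \<Lambda> \<mu>o K"
  unfolding profit_O_def
proof (rule cSup_upper[OF assms(4)])
  show "bdd_above (ondemand_profits V \<Lambda> \<mu>o K)"
    using bdd_above_hybrid[of V \<Lambda> 1 K 1 \<mu>o] assms
    by (auto elim!: bdd_above_mono simp: hybrid_profits_def)
qed

section \<open>Lower bounds from serving the whole market\<close>

text \<open>At demand \<open>\<Lambda>\<close>, lead time \<open>W\<close> costs
  \<open>\<Lambda> * W\<close> in revenue and \<open>ws / (\<mu>s * W)\<close> in staffing. Their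
  product is fixed, so their sum is least when they agree; this determines \<open>W\<close> and
  yields the square root term of \<open>C_bar_s\<close>.\<close>

lemma profit_S_ge:
  assumes "V > 0" "\<Lambda> > 0" "\<mu>s > 0" "ws > 0"
  shows "\<Lambda> * (V - C_bar_s \<Lambda> \<mu>s ws) \<le> profit_S V \<Lambda> \<mu>s ws"
proof -
  define W where "W = sqrt (ws / (\<Lambda> * \<mu>s))"
  have W: "W > 0" "W\<^sup>2 = ws / (\<Lambda> * \<mu>s)" using assms by (auto simp: W_def)
  have "ws / (\<mu>s * W) = \<Lambda> * W"
    using W assms by (simp add: field_simps power2_eq_square)
  then have "V * \<Lambda> - W * \<Lambda>\<^sup>2 / \<Lambda> - ws * ((\<Lambda> + 1 / W) / \<mu>s) = \<Lambda> * (V - C_bar_s \<Lambda> \<mu>s ws)"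
    using assms W(1) by (simp add: C_bar_s_def flip: W_def) (simp add: field_simps power2_eq_square)
  then show ?thesis
    using standard_profit_mem[of \<Lambda> \<mu>s W \<Lambda> V ws] le_profit_S[OF assms(1,2,4)] assms W(1) by simp
qed

text \<open>\<open>L ^ 3 / (1 + L)\<close> increases strictly from 0 without bound, so the maximum
  exists and is attained with equality.\<close>

lemma L_bar_o_root:
  assumes "\<Lambda> > 0" "\<mu>o > 0" "K > 0"
  shows "L_bar_o \<Lambda> \<mu>o K > 0"
    and "L_bar_o \<Lambda> \<mu>o K ^ 3 / (1 + L_bar_o \<Lambda> \<mu>o K) = 2 * \<Lambda>\<^sup>2 / (K * \<mu>o\<^sup>2)"
proof -
  define c where "c = 2 * \<Lambda>\<^sup>2 / (K * \<mu>o\<^sup>2)"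
  define f where "f L = L ^ 3 / (1 + L)" for L :: real
  have c: "c > 0" using assms by (simp add: c_def)
  have mono: "f x < f y" if "0 \<le> x" "x < y" for x y
  proof -
    \<comment> \<open>After cross-multiplication the cubes and the mixed terms
      \<open>x ^ 3 * y\<close> and \<open>x * y ^ 3\<close> are compared separately.\<close>
    have "x ^ 3 < y ^ 3" using that by (intro power_strict_mono) auto
    moreover have "x * y * x\<^sup>2 \<le> x * y * y\<^sup>2"
      using that by (intro mult_left_mono power_mono) auto
    ultimately have "x ^ 3 * (1 + y) < y ^ 3 * (1 + x)"
      by (simp add: algebra_simps power2_eq_square power3_eq_cube)
    then show ?thesis using that by (simp add: f_def divide_simps)
  qed
  have "\<exists>L. 0 \<le> L \<and> L \<le> 1 + 2 * c \<and> f L = c"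
  proof (rule IVT')
    show "f 0 \<le> c" using c by (simp add: f_def)
    \<comment> \<open>The endpoint \<open>1 + 2 * c\<close> is large enough: its cube contains
      \<open>6 * c + 12 * c\<^sup>2\<close>, against \<open>2 * c + 2 * c\<^sup>2\<close> on the
      left.\<close>
    have "c * (2 + 2 * c) \<le> (1 + 2 * c) ^ 3"
      using c by (simp add: power3_eq_cube algebra_simps)
    then show "c \<le> f (1 + 2 * c)" using c by (simp add: f_def pos_le_divide_eq)
    show "continuous_on {0..1 + 2 * c} f"
      unfolding f_def by (intro continuous_intros) auto
  qed (use c in simp)
  then obtain L where L: "0 \<le> L" "f L = c" by blast
  then have "L > 0" using c by (cases "L = 0") (auto simp: f_def)
  have "L_bar_o \<Lambda> \<mu>o K = L"
    unfolding L_bar_o_def c_def[symmetric] f_def[symmetric]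
  proof (rule Greatest_equality)
    show "0 < L \<and> f L \<le> c" using \<open>L > 0\<close> L by simp
    show "y \<le> L" if "0 < y \<and> f y \<le> c" for y
      using that mono[of L y] L by force
  qed
  then show "L_bar_o \<Lambda> \<mu>o K > 0"
    "L_bar_o \<Lambda> \<mu>o K ^ 3 / (1 + L_bar_o \<Lambda> \<mu>o K) = 2 * \<Lambda>\<^sup>2 / (K * \<mu>o\<^sup>2)"
    using \<open>L > 0\<close> L by (auto simp: f_def c_def)
qed

text \<open>At demand \<open>\<Lambda>\<close> and with \<open>L = \<Lambda> * W\<close>, the loss
  is \<open>L + \<Lambda>\<^sup>2 * (1 + 1 / L)\<^sup>2 / (K * \<mu>o\<^sup>2)\<close>. Its
  first-order condition is the equation satisfied by \<open>L_bar_o\<close>, hence the lead time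
  \<open>L / \<Lambda>\<close>.\<close>

lemma profit_O_ge:
  assumes "V > 0" "\<Lambda> > 0" "\<mu>o > 0" "K > 0"
  shows "\<Lambda> * (V - C_bar_o \<Lambda> \<mu>o K) \<le> profit_O V \<Lambda> \<mu>o K"
proof -
  define L where "L = L_bar_o \<Lambda> \<mu>o K"
  note L = L_bar_o_root[OF assms(2-4), folded L_def]
  have "(\<Lambda> + 1 / (L / \<Lambda>))\<^sup>2 / (K * \<mu>o\<^sup>2) = 2 * \<Lambda>\<^sup>2 / (K * \<mu>o\<^sup>2) * ((1 + 1 / L)\<^sup>2 / 2)"
    using L(1) assms by (simp add: field_simps power2_eq_square)
  also have "\<dots> = L * (1 + L) / 2"
    unfolding L(2)[symmetric] using L(1)
    by (simp add: divide_simps) (simp add: algebra_simps power2_eq_square power3_eq_cube)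
  finally have cost: "(\<Lambda> + 1 / (L / \<Lambda>))\<^sup>2 / (K * \<mu>o\<^sup>2) = L * (1 + L) / 2" .
  have "V * \<Lambda> - L / \<Lambda> * \<Lambda>\<^sup>2 / \<Lambda> - (\<Lambda> + 1 / (L / \<Lambda>))\<^sup>2 / (K * \<mu>o\<^sup>2)
      = \<Lambda> * (V - C_bar_o \<Lambda> \<mu>o K)"
    unfolding cost C_bar_o_def L_def[symmetric]
    using assms by (simp add: field_simps power2_eq_square)
  then show ?thesis
    using ondemand_profit_mem[of \<Lambda> \<mu>o K "L / \<Lambda>" \<Lambda> V] le_profit_O[OF assms(1,2,4)] assms L(1)
    by simp
qed

text \<open>No on-demand configuration has zero demand, so the value 0 is only approached, as the demand
  \<open>l\<close> tends to 0 with lead time \<open>1 / l\<close>.\<close>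

lemma profit_O_nonneg:
  assumes "V > 0" "\<Lambda> > 0" "\<mu>o > 0" "K > 0"
  shows "0 \<le> profit_O V \<Lambda> \<mu>o K"
proof (rule tendsto_upperbound)
  \<comment> \<open>With \<open>W = 1 / l\<close> the capacity \<open>l + 1 / W\<close> is
    \<open>2 * l\<close>, and \<open>W * l\<^sup>2 / \<Lambda>\<close> is
    \<open>l / \<Lambda>\<close>.\<close>
  let ?f = "\<lambda>l. V * l - l / \<Lambda> - (2 * l)\<^sup>2 / (K * \<mu>o\<^sup>2)"
  show "(?f \<longlongrightarrow> 0) (at_right 0)"
    using assms by (auto intro!: tendsto_eq_intros)
  have "?f l \<le> profit_O V \<Lambda> \<mu>o K" if "0 < l" "l < \<Lambda>" for l
    using ondemand_profit_mem[of \<Lambda> \<mu>o K "1 / l" l V] le_profit_O[OF assms(1,2,4)] assms that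
    by (simp add: power2_eq_square)
  then show "\<forall>\<^sub>F l in at_right 0. ?f l \<le> profit_O V \<Lambda> \<mu>o K"
    using assms(2) by (auto simp: eventually_at_right_field)
qed simp

text \<open>The hypothesis \<open>a \<le> b\<close> covers \<open>b = 0\<close>, where \<open>a / b = 0\<close> and \<open>a\<close> itself must vanish.\<close>

lemma one_minus_ratio_mono:
  fixes a b b' :: real
  assumes "0 \<le> a" "a \<le> b" "b \<le> b'"
  shows "1 - a / b \<le> 1 - a / b'"
proof (cases "b = 0")
  case False
  then show ?thesis using assms by (simp add: frac_le)
qed (use assms in auto)

lemma one_minus_ratio_nonneg:
  fixes a b :: real
  assumes "0 \<le> a" "a \<le> b"
  shows "0 \<le> 1 - a / b"
  \<comment> \<open>Division by zero gives 0, so \<open>b = 0\<close> leaves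
    \<open>0 \<le> 1\<close>.\<close>
  using assms by (cases "b = 0") auto

text \<open>Replacing \<open>b\<close> by its cap and then \<open>a\<close> by its lower bound gives
  exactly \<open>C / V\<close>. Since \<open>V - C\<close> may be negative, \<open>0 \<le> a\<close>
  is a separate hypothesis, used when \<open>b\<close> is enlarged.\<close>

lemma one_minus_ratio_le:
  fixes a b :: real
  assumes "V > 0" "\<Lambda> > 0" "0 \<le> a" "a \<le> b" "b \<le> \<Lambda> * V" "\<Lambda> * (V - C) \<le> a"
  shows "1 - a / b \<le> C / V"
proof -
  have "1 - a / b \<le> 1 - a / (\<Lambda> * V)"
    by (rule one_minus_ratio_mono) (use assms in auto)
  also have "\<dots> \<le> 1 - \<Lambda> * (V - C) / (\<Lambda> * V)"
    using divide_right_mono[OF assms(6), of "\<Lambda> * V"] assms(1,2) by simp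
  also have "\<dots> = C / V" using assms(1,2) by (simp add: field_simps)
  finally show ?thesis .
qed

theorem theorem6:
  fixes V \<Lambda> \<mu>\<^sub>s \<mu>\<^sub>o w\<^sub>s K :: real
  assumes "V > 0" "\<Lambda> > 0" "\<mu>\<^sub>s > 0" "\<mu>\<^sub>o > 0" "w\<^sub>s > 0" "K > 0"
    and "V \<ge> C_bar_s \<Lambda> \<mu>\<^sub>s w\<^sub>s"
  shows "mono_on {0<..} (\<lambda>K'. value_ondemand V \<Lambda> \<mu>\<^sub>s \<mu>\<^sub>o w\<^sub>s K') \<and>
    antimono_on {w. w > 0 \<and> V \<ge> C_bar_s \<Lambda> \<mu>\<^sub>s w} (\<lambda>w. value_standard V \<Lambda> \<mu>\<^sub>s \<mu>\<^sub>o w K) \<and>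
    0 \<le> value_ondemand V \<Lambda> \<mu>\<^sub>s \<mu>\<^sub>o w\<^sub>s K \<and>
    value_ondemand V \<Lambda> \<mu>\<^sub>s \<mu>\<^sub>o w\<^sub>s K \<le> C_bar_s \<Lambda> \<mu>\<^sub>s w\<^sub>s / V \<and>
    0 \<le> value_standard V \<Lambda> \<mu>\<^sub>s \<mu>\<^sub>o w\<^sub>s K \<and>
    value_standard V \<Lambda> \<mu>\<^sub>s \<mu>\<^sub>o w\<^sub>s K \<le> C_bar_o \<Lambda> \<mu>\<^sub>o K / V"
proof -
  have S: "0 \<le> profit_S V \<Lambda> \<mu>\<^sub>s w\<^sub>s"
  proof -
    have "0 \<le> \<Lambda> * (V - C_bar_s \<Lambda> \<mu>\<^sub>s w\<^sub>s)" using assms by simp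
    then show ?thesis using profit_S_ge[of V \<Lambda> \<mu>\<^sub>s w\<^sub>s] assms by linarith
  qed
  \<comment> \<open>\<open>V \<ge> C_bar_o\<close> is not assumed, so the lower bound by full
    coverage may be negative here; the limit argument gives the sign.\<close>
  have O: "0 \<le> profit_O V \<Lambda> \<mu>\<^sub>o K" using profit_O_nonneg assms by simp
  \<comment> \<open>\<open>profit_S\<close> does not depend on the pool size: only the denominator
    grows.\<close>
  have "mono_on {0<..} (\<lambda>K'. value_ondemand V \<Lambda> \<mu>\<^sub>s \<mu>\<^sub>o w\<^sub>s K')"
    unfolding value_ondemand_def using assms S
    by (intro mono_onI one_minus_ratio_mono profit_S_le_hybrid profit_hybrid_mono_K) auto
  \<comment> \<open>\<open>profit_O\<close> does not depend on the employees' wage: only the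
    denominator shrinks as it rises.\<close>
  moreover have "antimono_on {w. w > 0 \<and> V \<ge> C_bar_s \<Lambda> \<mu>\<^sub>s w} (\<lambda>w. value_standard V \<Lambda> \<mu>\<^sub>s \<mu>\<^sub>o w K)"
    unfolding value_standard_def using assms O
    by (intro monotone_onI one_minus_ratio_mono profit_O_le_hybrid profit_hybrid_antimono_ws) auto
  moreover have "0 \<le> value_ondemand V \<Lambda> \<mu>\<^sub>s \<mu>\<^sub>o w\<^sub>s K" "0 \<le> value_standard V \<Lambda> \<mu>\<^sub>s \<mu>\<^sub>o w\<^sub>s K"
    unfolding value_ondemand_def value_standard_def using assms S O
    by (intro one_minus_ratio_nonneg profit_S_le_hybrid profit_O_le_hybrid; simp)+
  moreover have "value_ondemand V \<Lambda> \<mu>\<^sub>s \<mu>\<^sub>o w\<^sub>s K \<le> C_bar_s \<Lambda> \<mu>\<^sub>s w\<^sub>s / V"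
    unfolding value_ondemand_def
    by (rule one_minus_ratio_le[of V \<Lambda>])
      (use assms S profit_S_le_hybrid profit_hybrid_bounds profit_S_ge in auto)
  moreover have "value_standard V \<Lambda> \<mu>\<^sub>s \<mu>\<^sub>o w\<^sub>s K \<le> C_bar_o \<Lambda> \<mu>\<^sub>o K / V"
    unfolding value_standard_def
    by (rule one_minus_ratio_le[of V \<Lambda>])
      (use assms O profit_O_le_hybrid profit_hybrid_bounds profit_O_ge in auto)
  ultimately show ?thesis by blast
qed

end
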